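(* Let $f\in\mathbb{Q}[X]=\mathbb{Q}[X_1,\dots,X_n]$ be a polynomial, let $e\ge0$ be an integer, and let $d=\lceil e+\deg(f)/2\rceil$. Then for any subset $\mathcal{T}\subseteq\mathrm{Terms}[X;\deg\le e]$ the following are equivalent: 1. $f\notin\mathrm{SOS}/\mathrm{SOS}_{\mathcal{T}}$. 2. There exists a rational vector $\hat y=(\hat y_\alpha)_{\alpha\in\mathbb{N}^n_{2d}}\in\mathbb{Q}^m$, with $m=\binom{n+2d}{2d}$, such that the associated linear form $L_{\hat y}\in(\mathbb{R}[X]_{2d})^*$ satisfies $L_{\hat y}(fv^2)<0$ for every nonzero $v\in\mathbb{R}[X]$ with $\mathrm{supp}(v)\subseteq\mathcal{T}$, and $L_{\hat y}(u^2)\ge0$ for every $u\in\mathbb{R}[X]$ with $\mathrm{supp}(u)\subseteq\mathrm{Terms}[X;\deg\le d]$.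
   Context: Let $n\ge1$, $X=(X_1,\dots,X_n)$, and $X^\alpha=X_1^{\alpha_1}\cdots X_n^{\alpha_n}$. For $t\in\mathbb{N}$, $\mathbb{N}^n_t=\{\alpha\in\mathbb{N}^n : |\alpha|=\sum_i\alpha_i\le t\}$, and $\mathbb{R}[X]_t$ is the space of real polynomials of total degree $\le t$. $\mathrm{Terms}[X;\deg\le e]$ is the set of all monomials (terms) $X^\alpha$ with $|\alpha|\le e$. For $p=\sum_\alpha p_\alpha X^\alpha\in\mathbb{R}[X]$, $\mathrm{supp}(p)=\{X^\alpha : p_\alpha\ne0\}$, and $\deg(p)$ is the total degree (with $\deg(0)=0$ by convention). For a set $\mathcal{T}$ of terms, $\mathrm{SOS}/\mathrm{SOS}_{\mathcal{T}}$ is the set of all fractions $\sum_i u_i^2\big/\sum_j v_j^2$ (finite sums, nonzero denominator) with $u_i,v_j\in\mathbb{R}[X]$ and $\mathrm{supp}(v_j)\subseteq\mathcal{T}$ for all $j$ (no restriction on the $u_i$). For $y=(y_\alpha)_{\alpha\in\mathbb{N}^n_{2d}}$, the associated linear form is $L_y(p)=\sum_\alpha y_\alpha p_\alpha$ for $p=\sum_\alpha p_\alpha X^\alpha\in\mathbb{R}[X]_{2d}$. *)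

theory Defs
  imports Complex_Main "HOL-Library.Poly_Mapping" "HOL-Library.FuncSet" "HOL-Library.Cardinality"
    "HOL-Computational_Algebra.Fraction_Field"
begin

text \<open>
  A finite nonempty type \<open>'n\<close> indexes the variables, so \<open>n = CARD('n) \<ge> 1\<close>.
  A term \<open>X\<^sup>\<alpha>\<close> is represented by its exponent vector \<open>\<alpha>\<close>, so that \<open>supp(p)\<close> is
  \<open>Poly_Mapping.keys p\<close>.
\<close>

type_synonym 'n monom = "'n \<Rightarrow>\<^sub>0 nat"
type_synonym 'n rpoly = "'n monom \<Rightarrow>\<^sub>0 real"

definition mdeg :: "'n::finite monom \<Rightarrow> nat" where
  "mdeg \<alpha> = (\<Sum>i\<in>UNIV. Poly_Mapping.lookup \<alpha> i)"

text \<open>This is both the index set of exponents \<open>\<alpha>\<close> with \<open>|\<alpha>| \<le> t\<close> and the set of terms of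
  degree at most \<open>t\<close>.\<close>

definition Terms_le :: "nat \<Rightarrow> 'n::finite monom set" where
  "Terms_le t = {\<alpha>. mdeg \<alpha> \<le> t}"

lemma card_Terms_le:
  "card (Terms_le t :: 'n::finite monom set) = (CARD('n) + t) choose t"
proof -
  obtain xs :: "'n list" where xs: "set xs = UNIV" "distinct xs"
    using finite_distinct_list[of "UNIV :: 'n set"] by auto
  have len: "length xs = CARD('n)" using distinct_card[OF xs(2)] xs(1) by simp
  have sumxs: "sum_list (map g xs) = (\<Sum>i\<in>UNIV. g i)" for g :: "'n \<Rightarrow> nat"
    using sum_list_distinct_conv_sum_set[OF xs(2), of g] xs(1) by simp
  let ?L = "{l::nat list. length l = CARD('n) + 1 \<and> sum_list l = t}"
  let ?h = "\<lambda>\<alpha>::'n monom. (t - mdeg \<alpha>) # map (Poly_Mapping.lookup \<alpha>) xs"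
  have "bij_betw ?h (Terms_le t) ?L"
  proof (rule bij_betw_imageI)
    show "inj_on ?h (Terms_le t)"
    proof (rule inj_onI)
      fix \<alpha> \<beta> :: "'n monom" assume "?h \<alpha> = ?h \<beta>"
      then have "Poly_Mapping.lookup \<alpha> i = Poly_Mapping.lookup \<beta> i" for i
        using xs(1) by simp
      then show "\<alpha> = \<beta>" by (rule poly_mapping_eqI)
    qed
    show "?h ` Terms_le t = ?L"
    proof (intro equalityI subsetI)
      fix l assume "l \<in> ?h ` Terms_le t"
      then show "l \<in> ?L" by (auto simp: Terms_le_def len sumxs mdeg_def)
    next
      fix l assume l: "l \<in> ?L"
      then obtain a k where ak: "l = a # k" "length k = length xs" "a + sum_list k = t"
        using len by (cases l) auto
      obtain g where g: "map g xs = k"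
      proof
        show "map (\<lambda>x. the (map_of (zip xs k) x)) xs = k"
          using map_fst_zip[of xs k] ak(2) xs(2)
          by (intro nth_equalityI) (auto simp: map_of_zip_nth)
      qed
      define \<alpha> :: "'n monom" where "\<alpha> = Abs_poly_mapping g"
      have \<alpha>: "Poly_Mapping.lookup \<alpha> = g"
        by (simp add: \<alpha>_def Abs_poly_mapping_inverse)
      have "mdeg \<alpha> = sum_list k" using sumxs[of g] g by (simp add: mdeg_def \<alpha>)
      then have "\<alpha> \<in> Terms_le t" "?h \<alpha> = l" using ak g by (auto simp: Terms_le_def \<alpha>)
      then show "l \<in> ?h ` Terms_le t" by force
    qed
  qed
  then have "card (Terms_le t :: 'n monom set) = card ?L" by (rule bij_betw_same_card)
  also have "\<dots> = (t + (CARD('n) + 1) - 1) choose t" by (rule card_length_sum_list)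
  finally show ?thesis by (simp add: add.commute)
qed

definition tdeg :: "'n::finite rpoly \<Rightarrow> nat" where
  "tdeg p = (if p = 0 then 0 else Max (mdeg ` Poly_Mapping.keys p))"

text \<open>
  The fractions live in the field of rational functions, that is, the fraction field of the
  polynomial ring. The library derives that this ring is an integral domain from a linear order
  on the index type; the order (a numbering of the variables) plays no other role.
\<close>

definition SOS_frac :: "'n::{finite,linorder} monom set \<Rightarrow> 'n rpoly fract set" where
  "SOS_frac T = {Fract (\<Sum>u\<leftarrow>us. u\<^sup>2) (\<Sum>v\<leftarrow>vs. v\<^sup>2) | us vs.
     (\<forall>v\<in>set vs. Poly_Mapping.keys v \<subseteq> T) \<and> (\<Sum>v\<leftarrow>vs. v\<^sup>2) \<noteq> 0}"

text \<open>
  \<open>lin_form t y\<close> is the linear form associated with a vector \<open>y\<close> indexed by \<open>Terms_le t\<close>;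
  it is only meaningful on polynomials of total degree at most \<open>t\<close>.
\<close>

definition lin_form :: "nat \<Rightarrow> ('n::finite monom \<Rightarrow> real) \<Rightarrow> 'n rpoly \<Rightarrow> real" where
  "lin_form t y p = (\<Sum>\<alpha>\<in>Terms_le t. y \<alpha> * Poly_Mapping.lookup p \<alpha>)"

end

theory Submission
  imports Defs "HOL-Analysis.Function_Topology"
begin

text \<open>
  Clearing denominators, \<open>f\<close> lies in \<open>SOS/SOS\<^sub>T\<close> iff \<open>f * (\<Sum>v\<^sup>2) = (\<Sum>u\<^sup>2)\<close> for some
  \<open>v\<close> supported in \<open>T\<close>, not all zero. A functional that is negative on all \<open>f * v\<^sup>2\<close> and
  nonnegative on squares excludes such an identity; the \<open>u\<close> are within its reach, since the
  leading terms of the \<open>u\<^sup>2\<close> do not cancel and therefore \<open>deg u \<le> d\<close>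
  (\<open>sum_squares_leading_term\<close>, \<open>certificate_imp_not_SOS_frac\<close>).

  The converse is a separation argument in the space of polynomials of degree at most \<open>2d\<close>.
  A functional is a certificate if it is positive on all \<open>u\<^sup>2 - f * v\<^sup>2\<close> with \<open>(u, v) \<noteq> 0\<close>, that
  is, on the nontrivial values of a quadratic map from one finite-dimensional space to another.
  Finite sums of values are the images of positive semidefinite matrices under a linear map,
  because such matrices are sums of rank one matrices (\<open>psd_on_sum_rank_one\<close>, by Schur complements). The matrices of trace one
  form a compact convex set; if \<open>f\<close> is not in \<open>SOS/SOS\<^sub>T\<close>, its image is a compact convex set that
  misses the origin. The point of this image nearest to the origin separates it strictly from
  the origin, and by boundedness the separating functional may be moved to a rational
  one (\<open>quadratic_map_alternative\<close>, \<open>not_SOS_frac_imp_certificate\<close>).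

  The dimension depends on \<open>d\<close>, so vectors and matrices are functions on finite index sets, and
  compactness is that of the product topology.
\<close>

section \<open>Positive semidefinite matrices over a finite index set\<close>


definition quad_form :: "'a set \<Rightarrow> ('a \<times> 'a \<Rightarrow> real) \<Rightarrow> ('a \<Rightarrow> real) \<Rightarrow> real" where
  "quad_form A G x = (\<Sum>i\<in>A. \<Sum>j\<in>A. G (i, j) * (x i * x j))"

definition psd_on :: "'a set \<Rightarrow> ('a \<times> 'a \<Rightarrow> real) \<Rightarrow> bool" where
  "psd_on A G \<longleftrightarrow> (\<forall>i\<in>A. \<forall>j\<in>A. G (i, j) = G (j, i)) \<and> (\<forall>x. 0 \<le> quad_form A G x)"

lemma psd_on_sym: "psd_on A G \<Longrightarrow> i \<in> A \<Longrightarrow> j \<in> A \<Longrightarrow> G (i, j) = G (j, i)"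
  by (simp add: psd_on_def)

text \<open>
  Completing the square eliminates one index at a time; this expansion isolates the dependence
  of the form on a single coordinate.
\<close>

lemma quad_form_insert:
  assumes "finite A" "a \<notin> A" "\<And>i j. i \<in> insert a A \<Longrightarrow> j \<in> insert a A \<Longrightarrow> G (i, j) = G (j, i)"
  shows "quad_form (insert a A) G (x(a := t)) =
    G (a, a) * t\<^sup>2 + 2 * t * (\<Sum>j\<in>A. G (a, j) * x j) + quad_form A G x"
proof -
  let ?y = "x(a := t)"
  have on_A: "(\<Sum>j\<in>A. h j * ?y j) = (\<Sum>j\<in>A. h j * x j)" for h
    using assms(2) by (intro sum.cong) auto
  have 1: "(\<Sum>j\<in>insert a A. G (i, j) * (?y i * ?y j)) =
      t * (G (a, i) * x i) + (\<Sum>j\<in>A. G (i, j) * (x i * x j))" if "i \<in> A" for i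
  proof -
    have "i \<noteq> a" "G (i, a) = G (a, i)" using assms(2,3) that by auto
    then show ?thesis
      using assms(1,2) on_A[of "\<lambda>j. G (i, j) * x i"] by (simp add: mult.assoc)
  qed
  have 2: "(\<Sum>j\<in>insert a A. G (a, j) * (?y a * ?y j)) =
      G (a, a) * t\<^sup>2 + t * (\<Sum>j\<in>A. G (a, j) * x j)"
    using assms(1,2) on_A[of "\<lambda>j. t * G (a, j)"]
    by (simp add: power2_eq_square sum_distrib_left mult.assoc mult.left_commute)
  have "quad_form (insert a A) G ?y = (\<Sum>j\<in>insert a A. G (a, j) * (?y a * ?y j)) +
      (\<Sum>i\<in>A. \<Sum>j\<in>insert a A. G (i, j) * (?y i * ?y j))"
    unfolding quad_form_def by (rule sum.insert[OF assms(1,2)])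
  also have "(\<Sum>i\<in>A. \<Sum>j\<in>insert a A. G (i, j) * (?y i * ?y j)) =
      (\<Sum>i\<in>A. t * (G (a, i) * x i) + (\<Sum>j\<in>A. G (i, j) * (x i * x j)))"
    by (intro sum.cong refl 1)
  finally show ?thesis
    unfolding 2 by (simp add: sum.distrib quad_form_def flip: sum_distrib_left)
qed

lemma quad_form_mono_neutral:
  assumes "finite A" "B \<subseteq> A" "\<And>i. i \<in> A - B \<Longrightarrow> x i = 0"
  shows "quad_form A G x = quad_form B G x"
proof -
  have "(\<Sum>j\<in>A. G (i, j) * (x i * x j)) = (\<Sum>j\<in>B. G (i, j) * (x i * x j))" for i
    using assms by (intro sum.mono_neutral_right) auto
  then have "quad_form A G x = (\<Sum>i\<in>A. \<Sum>j\<in>B. G (i, j) * (x i * x j))"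
    by (simp add: quad_form_def)
  also have "\<dots> = quad_form B G x"
    unfolding quad_form_def using assms by (intro sum.mono_neutral_right) auto
  finally show ?thesis .
qed

lemma psd_on_diag_nonneg:
  assumes "finite A" "psd_on A G" "i \<in> A"
  shows "0 \<le> G (i, i)"
proof -
  have "quad_form A G (\<lambda>k. if k = i then 1 else 0) = quad_form {i} G (\<lambda>k. if k = i then 1 else 0)"
    using assms by (intro quad_form_mono_neutral) auto
  moreover have "quad_form A G (\<lambda>k. if k = i then 1 else 0) \<ge> 0"
    using assms by (auto simp: psd_on_def)
  ultimately show ?thesis by (simp add: quad_form_def)
qed

lemma psd_on_pair:
  assumes "finite A" "psd_on A G" "i \<in> A" "j \<in> A" "i \<noteq> j"
  shows "0 \<le> G (i, i) * t\<^sup>2 + 2 * t * G (i, j) + G (j, j)"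
proof -
  define x :: "'a \<Rightarrow> real" where "x = (\<lambda>k. if k = j then 1 else 0)(i := t)"
  have "quad_form A G x = quad_form {i, j} G x"
    using assms by (intro quad_form_mono_neutral) (auto simp: x_def)
  also have "\<dots> = G (i, i) * t\<^sup>2 + 2 * t * G (i, j) + G (j, j)"
    unfolding x_def using assms
    by (subst quad_form_insert) (auto simp: quad_form_def psd_on_def)
  finally show ?thesis using assms by (metis psd_on_def)
qed

text \<open>
  With a vanishing diagonal entry the form restricted to the indices \<open>i, j\<close> is affine in
  the \<open>i\<close>-th coordinate, hence it is bounded below only if its slope vanishes.
\<close>

lemma psd_on_zero_diag:
  assumes "finite A" "psd_on A G" "i \<in> A" "j \<in> A" "G (i, i) = 0"
  shows "G (i, j) = 0"
proof (cases "i = j")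
  case False
  show ?thesis
  proof (rule ccontr)
    assume nz: "G (i, j) \<noteq> 0"
    have "0 \<le> 2 * (- (G (j, j) + 1) / (2 * G (i, j))) * G (i, j) + G (j, j)"
      using psd_on_pair[OF assms(1-4) False, of "- (G (j, j) + 1) / (2 * G (i, j))"] assms(5) by simp
    also have "\<dots> = -1" using nz by (simp add: field_simps)
    finally show False by simp
  qed
qed (use assms in simp)

text \<open>
  The Schur complement is the minimum of the form over the \<open>a\<close>-th coordinate, attained at
  \<open>- c / G (a, a)\<close>. If \<open>G (a, a) = 0\<close>, division by zero gives \<open>0\<close>, and the
  statement degenerates to the restriction of \<open>G\<close> to \<open>A\<close>, which is positive
  semidefinite as well; so both cases have the same proof.
\<close>

lemma psd_on_Schur_complement:
  assumes "finite A" "a \<notin> A" "psd_on (insert a A) G"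
  shows "psd_on A (\<lambda>(i, j). G (i, j) - G (a, i) * G (a, j) / G (a, a))"
  unfolding psd_on_def
proof (intro conjI ballI allI)
  fix i j assume "i \<in> A" "j \<in> A"
  then have "G (i, j) = G (j, i)" by (intro psd_on_sym[OF assms(3)]) auto
  then show "(\<lambda>(i, j). G (i, j) - G (a, i) * G (a, j) / G (a, a)) (i, j) =
    (\<lambda>(i, j). G (i, j) - G (a, i) * G (a, j) / G (a, a)) (j, i)"
    by (simp add: mult.commute)
next
  fix x
  let ?s = "G (a, a)"
  define c where "c = (\<Sum>j\<in>A. G (a, j) * x j)"
  have complete_square: "?s * (- c / ?s)\<^sup>2 + 2 * (- c / ?s) * c = - (c * c / ?s)"
    by (cases "?s = 0") (simp_all add: power2_eq_square)
  have "0 \<le> quad_form (insert a A) G (x(a := - c / ?s))"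
    using assms(3) unfolding psd_on_def by blast
  also have "\<dots> = ?s * (- c / ?s)\<^sup>2 + 2 * (- c / ?s) * c + quad_form A G x"
    unfolding c_def by (rule quad_form_insert[OF assms(1,2)]) (rule psd_on_sym[OF assms(3)])
  also have "\<dots> = quad_form A G x - c * c / ?s"
    unfolding complete_square by simp
  also have "\<dots> = (\<Sum>i\<in>A. \<Sum>j\<in>A. G (i, j) * (x i * x j) - (G (a, i) * x i) * (G (a, j) * x j) / ?s)"
    by (simp add: quad_form_def c_def sum_product sum_subtractf flip: sum_divide_distrib)
  also have "\<dots> = quad_form A (\<lambda>(i, j). G (i, j) - G (a, i) * G (a, j) / ?s) x"
    unfolding quad_form_def by (intro sum.cong refl) (simp add: left_diff_distrib right_diff_distrib mult_ac)
  finally show "0 \<le> quad_form A (\<lambda>(i, j). G (i, j) - G (a, i) * G (a, j) / ?s) x" .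
qed

text \<open>
  This is what turns a Gram matrix into a sum of squares: splitting off the rank one matrix
  spanned by the row of \<open>a\<close> leaves the Schur complement, which lives on fewer indices.
  For a zero pivot the row of \<open>a\<close> vanishes, so that nothing has to be split off.
\<close>

lemma psd_on_sum_rank_one:
  assumes "finite A" "psd_on A G"
  shows "\<exists>ws. \<forall>i\<in>A. \<forall>j\<in>A. G (i, j) = (\<Sum>w\<leftarrow>ws. w i * w j)"
  using assms
proof (induction A arbitrary: G rule: finite_induct)
  case (insert a A)
  let ?s = "G (a, a)"
  obtain ws where ws: "\<And>i j. i \<in> A \<Longrightarrow> j \<in> A \<Longrightarrow>
      G (i, j) - G (a, i) * G (a, j) / ?s = (\<Sum>w\<leftarrow>ws. w i * w j)"
    using insert.IH[OF psd_on_Schur_complement[OF insert.hyps insert.prems]] by auto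
  define w0 where "w0 = (\<lambda>i. G (a, i) / sqrt ?s)"
  define ws' where "ws' = w0 # map (\<lambda>w. w(a := 0)) ws"
  have s: "?s \<ge> 0" using psd_on_diag_nonneg[of "insert a A" G a] insert.hyps insert.prems by auto
  have w0: "w0 i * w0 j = G (a, i) * G (a, j) / ?s" for i j
    using s by (simp add: w0_def)
  have sym: "G (i, j) = G (j, i)" if "i \<in> insert a A" "j \<in> insert a A" for i j
    by (rule psd_on_sym[OF insert.prems that])
  have row: "G (a, a) * G (a, j) / ?s = G (a, j)" if "j \<in> insert a A" for j
    using psd_on_zero_diag[of "insert a A" G a j] insert.hyps insert.prems that by (cases "?s = 0") auto
  have split: "(\<Sum>w\<leftarrow>ws'. w i * w j) = G (a, i) * G (a, j) / ?s +
      (\<Sum>w\<leftarrow>ws. (w(a := 0)) i * (w(a := 0)) j)" for i j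
    by (simp add: ws'_def w0 o_def del: fun_upd_apply)
  have "G (i, j) = (\<Sum>w\<leftarrow>ws'. w i * w j)" if ij: "i \<in> insert a A" "j \<in> insert a A" for i j
  proof -
    consider "i = a" | "j = a" | "i \<in> A" "j \<in> A" using ij by auto
    then show ?thesis
    proof cases
      case 1
      then show ?thesis using row[OF ij(2)] by (simp add: split)
    next
      case 2
      then show ?thesis using row[OF ij(1)] sym[OF ij] by (simp add: split mult.commute)
    next
      case 3
      then have "i \<noteq> a" "j \<noteq> a" using insert.hyps by auto
      then have "(\<Sum>w\<leftarrow>ws'. w i * w j) = G (a, i) * G (a, j) / ?s + (\<Sum>w\<leftarrow>ws. w i * w j)"
        by (simp add: split)
      then show ?thesis using ws[OF 3] by linarith
    qed
  qed
  then have "\<forall>i\<in>insert a A. \<forall>j\<in>insert a A. G (i, j) = (\<Sum>w\<leftarrow>ws'. w i * w j)"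
    by (intro ballI)
  then show ?case by (rule exI)
qed simp

section \<open>Separation for quadratic maps\<close>

text \<open>
  Positive semidefinite matrices of trace one form a compact convex base of the cone of all
  positive semidefinite matrices. Entries outside \<open>A \<times> A\<close> are set to zero because
  compactness refers to the product topology on all functions.
\<close>

definition density_matrices :: "'a set \<Rightarrow> ('a \<times> 'a \<Rightarrow> real) set" where
  "density_matrices A = {G. psd_on A G \<and> (\<Sum>i\<in>A. G (i, i)) = 1 \<and> (\<forall>p. p \<notin> A \<times> A \<longrightarrow> G p = 0)}"

text \<open>
  Off the diagonal, the bound comes from evaluating the form at \<open>(1, 1)\<close> and
  \<open>(1, -1)\<close> on the indices \<open>i, j\<close>.
\<close>

lemma density_matrices_abs_le_1:
  assumes "finite A" "G \<in> density_matrices A"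
  shows "\<bar>G p\<bar> \<le> 1"
proof (cases "p \<in> A \<times> A")
  case True
  then obtain i j where p: "p = (i, j)" "i \<in> A" "j \<in> A" by auto
  have psd: "psd_on A G" and tr: "(\<Sum>i\<in>A. G (i, i)) = 1"
    using assms by (auto simp: density_matrices_def)
  note nn = psd_on_diag_nonneg[OF assms(1) psd]
  show ?thesis
  proof (cases "i = j")
    case True
    have "G (i, i) \<le> (\<Sum>i\<in>A. G (i, i))"
      using assms p nn by (intro member_le_sum) auto
    then show ?thesis using tr nn[of i] p True by auto
  next
    case False
    have "(\<Sum>k\<in>{i, j}. G (k, k)) \<le> (\<Sum>i\<in>A. G (i, i))"
      using assms p nn by (intro sum_mono2) auto
    then have "G (i, i) + G (j, j) \<le> 1" using False tr by simp
    moreover have "0 \<le> G (i, i) + 2 * G (i, j) + G (j, j)" "0 \<le> G (i, i) - 2 * G (i, j) + G (j, j)"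
      using psd_on_pair[OF assms(1) psd p(2,3) False, of 1]
        psd_on_pair[OF assms(1) psd p(2,3) False, of "-1"] by auto
    ultimately show ?thesis using p by auto
  qed
next
  case False
  then show ?thesis using assms by (cases p) (auto simp: density_matrices_def)
qed

lemma compact_density_matrices:
  assumes "finite A"
  shows "compact (density_matrices A)"
proof -
  let ?box = "PiE UNIV (\<lambda>_. {-1..1}) :: ('a \<times> 'a \<Rightarrow> real) set"
  have "compact ?box"
    using compactin_PiE[of "\<lambda>_. euclidean" UNIV "\<lambda>_. {-1..1::real}"]
    by (simp add: euclidean_product_topology)
  moreover have "density_matrices A \<subseteq> ?box"
    using density_matrices_abs_le_1[OF assms] by (fastforce simp: PiE_UNIV_domain abs_le_iff)
  moreover have "closed (density_matrices A)"
  proof -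
    have eq: "density_matrices A = (\<Inter>i\<in>A. \<Inter>j\<in>A. {G. G (i, j) = G (j, i)}) \<inter>
       (\<Inter>x. {G. 0 \<le> quad_form A G x}) \<inter> {G. (\<Sum>i\<in>A. G (i, i)) = 1} \<inter>
       (\<Inter>p\<in>-(A \<times> A). {G. G p = 0})"
      by (auto simp: density_matrices_def psd_on_def)
    show ?thesis
      unfolding eq quad_form_def
      by (intro closed_Int closed_INT ballI closed_Collect_eq closed_Collect_le continuous_intros
          continuous_on_product_coordinates)
  qed
  ultimately show ?thesis
    by (metis compact_Int_closed inf.absorb_iff2)
qed

lemma convex_density_matrices:
  assumes "G \<in> density_matrices A" "H \<in> density_matrices A" "0 \<le> t" "t \<le> 1"
  shows "(\<lambda>p. (1 - t) * G p + t * H p) \<in> density_matrices A"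
proof -
  have "quad_form A (\<lambda>p. (1 - t) * G p + t * H p) x =
      (1 - t) * quad_form A G x + t * quad_form A H x" for x
    by (simp add: quad_form_def distrib_right mult.assoc sum.distrib sum_distrib_left)
  then show ?thesis
    using assms
    by (auto simp: density_matrices_def psd_on_def sum.distrib simp flip: sum_distrib_left)
qed

lemma rank_one_density_matrix:
  assumes "(\<Sum>i\<in>A. (x i)\<^sup>2) = 1"
  shows "(\<lambda>(i, j). if i \<in> A \<and> j \<in> A then x i * x j else 0) \<in> density_matrices A"
proof -
  have "quad_form A (\<lambda>(i, j). if i \<in> A \<and> j \<in> A then x i * x j else 0) z = (\<Sum>i\<in>A. x i * z i)\<^sup>2" for z
    by (simp add: quad_form_def power2_eq_square sum_product ac_simps cong: sum.cong)
  then show ?thesis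
    using assms by (auto simp: density_matrices_def psd_on_def power2_eq_square)
qed

text \<open>
  The first variation at the point \<open>z\<close> of minimal norm of a convex set: moving a
  little from \<open>z\<close> towards \<open>w\<close> changes the squared norm by
  \<open>2 t c + t\<^sup>2 k\<close>, which is negative for small \<open>t\<close> unless \<open>c \<ge> 0\<close>.
\<close>

lemma nearest_point_inequality:
  fixes z w :: "'b \<Rightarrow> real"
  assumes "\<And>t. 0 < t \<Longrightarrow> t \<le> 1 \<Longrightarrow>
    (\<Sum>b\<in>B. (z b)\<^sup>2) \<le> (\<Sum>b\<in>B. ((1 - t) * z b + t * w b)\<^sup>2)"
  shows "(\<Sum>b\<in>B. (z b)\<^sup>2) \<le> (\<Sum>b\<in>B. z b * w b)"
proof (rule ccontr)
  define c where "c = (\<Sum>b\<in>B. z b * (w b - z b))"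
  define k where "k = (\<Sum>b\<in>B. (w b - z b)\<^sup>2)"
  assume "\<not> ?thesis"
  then have c: "c < 0" by (simp add: c_def power2_eq_square right_diff_distrib sum_subtractf)
  have k: "0 \<le> k" by (simp add: k_def sum_nonneg)
  have expand: "(\<Sum>b\<in>B. ((1 - t) * z b + t * w b)\<^sup>2) = (\<Sum>b\<in>B. (z b)\<^sup>2) + t * (2 * c + t * k)" for t
  proof -
    have "((1 - t) * z b + t * w b)\<^sup>2 =
        (z b)\<^sup>2 + (t * (2 * (z b * (w b - z b))) + t * (t * (w b - z b)\<^sup>2))" for b
      by (simp add: power2_eq_square algebra_simps)
    then show ?thesis
      by (simp add: c_def k_def sum.distrib distrib_left sum_distrib_left)
  qed
  \<comment> \<open>A step below \<open>- 2 c / k\<close> suffices; the increment in the denominator covers \<open>k = 0\<close>.\<close>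
  define t where "t = min 1 (- c / (k + 1))"
  have t: "0 < t" "t \<le> 1" using c k by (auto simp: t_def divide_neg_pos)
  have "t * k \<le> - c / (k + 1) * k" using k by (intro mult_right_mono) (auto simp: t_def)
  also have "\<dots> \<le> - c" using c k by (simp add: field_simps)
  finally have "2 * c + t * k < 0" using c by simp
  then have "t * (2 * c + t * k) < 0" using t by (simp add: mult_pos_neg)
  then show False using assms[OF t] expand[of t] by simp
qed

text \<open>
  A theorem of the alternative for the quadratic map \<open>Q(x) = (quad_form A (q b) x)\<^sub>b\<close>
  from \<open>\<real>\<^sup>A\<close> to \<open>\<real>\<^sup>B\<close>. The map \<open>\<Phi>\<close> is the linear extension of \<open>Q\<close> from rank
  one matrices to all matrices; the image of the density matrices under \<open>\<Phi>\<close> is compact and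
  convex, and it avoids the origin, since a density matrix mapped to zero would decompose into
  vectors whose values under \<open>Q\<close> add up to zero. The point \<open>z\<close> of this image nearest to the
  origin is a functional with values at least \<open>|z|\<^sup>2 > 0\<close> on the image. As the image is bounded,
  every \<open>y\<close> close to \<open>z\<close>, in particular a rational one, is still positive on it.
\<close>

lemma quadratic_map_alternative:
  fixes q :: "'b \<Rightarrow> 'a \<times> 'a \<Rightarrow> real"
  assumes A: "finite A" and B: "finite B"
    and no_zero: "\<And>xs. \<forall>b\<in>B. (\<Sum>x\<leftarrow>xs. quad_form A (q b) x) = 0 \<Longrightarrow> \<forall>x\<in>set xs. \<forall>i\<in>A. x i = 0"
  shows "\<exists>y. (\<forall>b. y b \<in> \<rat>) \<and>
    (\<forall>x. (\<exists>i\<in>A. x i \<noteq> 0) \<longrightarrow> 0 < (\<Sum>b\<in>B. y b * quad_form A (q b) x))"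
proof (cases "A = {}")
  case True
  show ?thesis by (rule exI[of _ "\<lambda>_. 0"]) (use True in auto)
next
  case ne: False
  define \<Phi> where "\<Phi> G b = (\<Sum>i\<in>A. \<Sum>j\<in>A. q b (i, j) * G (i, j))" for G :: "'a \<times> 'a \<Rightarrow> real" and b
  define R where "R x = (\<lambda>(i, j). if i \<in> A \<and> j \<in> A then x i * x j else 0)" for x :: "'a \<Rightarrow> real"
  have \<Phi>R: "\<Phi> (R x) b = quad_form A (q b) x" for x b
    by (simp add: \<Phi>_def R_def quad_form_def cong: sum.cong)
  have ne': "density_matrices A \<noteq> {}"
  proof -
    obtain a where "a \<in> A" using ne by auto
    then have "(\<Sum>i\<in>A. (if i = a then 1 else 0 :: real)\<^sup>2) = 1"
      using A by (simp add: if_distrib[of "\<lambda>x. x\<^sup>2"] cong: if_cong)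
    from rank_one_density_matrix[OF this] show ?thesis by (rule ex_in_conv[THEN iffD1, OF exI])
  qed
  have "continuous_on (density_matrices A) (\<lambda>G. \<Sum>b\<in>B. (\<Phi> G b)\<^sup>2)"
    unfolding \<Phi>_def
    by (intro continuous_intros continuous_on_subset[OF continuous_on_product_coordinates]) auto
  then obtain G where G: "G \<in> density_matrices A"
    and min: "\<And>H. H \<in> density_matrices A \<Longrightarrow> (\<Sum>b\<in>B. (\<Phi> G b)\<^sup>2) \<le> (\<Sum>b\<in>B. (\<Phi> H b)\<^sup>2)"
    using continuous_attains_inf[OF compact_density_matrices[OF A] ne'] by blast
  define z where "z = \<Phi> G"
  define c where "c = (\<Sum>b\<in>B. (z b)\<^sup>2)"
  have c_le: "c \<le> (\<Sum>b\<in>B. z b * \<Phi> H b)" if H: "H \<in> density_matrices A" for H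
    unfolding c_def
  proof (rule nearest_point_inequality)
    fix t :: real assume t: "0 < t" "t \<le> 1"
    have "\<Phi> (\<lambda>p. (1 - t) * G p + t * H p) b = (1 - t) * z b + t * \<Phi> H b" for b
      by (simp add: \<Phi>_def z_def distrib_left sum.distrib sum_distrib_left mult.left_commute)
    then show "(\<Sum>b\<in>B. (z b)\<^sup>2) \<le> (\<Sum>b\<in>B. ((1 - t) * z b + t * \<Phi> H b)\<^sup>2)"
      using min[OF convex_density_matrices[OF G H, of t]] t by (simp add: z_def)
  qed
  have "c > 0"
  proof (rule ccontr)
    assume "\<not> c > 0"
    moreover have "c \<ge> 0" by (simp add: c_def sum_nonneg)
    ultimately have "c = 0" by simp
    then have z0: "\<Phi> G b = 0" if "b \<in> B" for b
      using that B by (simp add: c_def z_def sum_nonneg_eq_0_iff)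
    obtain ws where ws: "\<And>i j. i \<in> A \<Longrightarrow> j \<in> A \<Longrightarrow> G (i, j) = (\<Sum>w\<leftarrow>ws. w i * w j)"
      using psd_on_sum_rank_one[OF A, of G] G by (auto simp: density_matrices_def)
    have "\<Phi> G b = (\<Sum>w\<leftarrow>ws. quad_form A (q b) w)" for b
    proof -
      have "\<Phi> G b = (\<Sum>i\<in>A. \<Sum>j\<in>A. \<Sum>w\<leftarrow>ws. q b (i, j) * (w i * w j))"
        by (simp add: \<Phi>_def ws sum_list_const_mult)
      also have "\<dots> = (\<Sum>w\<leftarrow>ws. quad_form A (q b) w)"
        by (induction ws) (simp_all add: quad_form_def sum.distrib)
      finally show ?thesis .
    qed
    then have "\<forall>x\<in>set ws. \<forall>i\<in>A. x i = 0" using no_zero[of ws] z0 by auto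
    then have "(\<Sum>w\<leftarrow>ws. w i * w i) = (\<Sum>w\<leftarrow>ws. 0)" if "i \<in> A" for i
      using that by (intro arg_cong[of _ _ sum_list] map_cong) auto
    then have "G (i, i) = 0" if "i \<in> A" for i
      unfolding ws[OF that that] using that by (simp only: sum_list_0)
    then show False using G by (simp add: density_matrices_def)
  qed
  \<comment> \<open>\<open>M\<close> bounds the sum of the absolute values of the entries of \<open>\<Phi> H\<close>, so a perturbation of \<open>z\<close> by less than
    \<open>\<epsilon>\<close> in each coordinate lowers the pairing with \<open>\<Phi> H\<close> by less than \<open>c\<close>.\<close>
  define M where "M = (\<Sum>b\<in>B. \<Sum>i\<in>A. \<Sum>j\<in>A. \<bar>q b (i, j)\<bar>)"
  have M: "M \<ge> 0" by (simp add: M_def sum_nonneg)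
  define \<epsilon> where "\<epsilon> = c / (M + 1)"
  have \<epsilon>: "\<epsilon> > 0" "\<epsilon> * M < c"
  proof -
    show "\<epsilon> > 0" using M \<open>c > 0\<close> by (simp add: \<epsilon>_def)
    moreover have "\<epsilon> * (M + 1) = c" using M by (simp add: \<epsilon>_def)
    ultimately show "\<epsilon> * M < c" by (simp add: distrib_left)
  qed
  have "\<forall>b. \<exists>r. r \<in> \<rat> \<and> \<bar>r - z b\<bar> < \<epsilon>"
  proof
    fix b
    obtain r where "r \<in> \<rat>" "z b - \<epsilon> < r" "r < z b + \<epsilon>"
      using Rats_dense_in_real[of "z b - \<epsilon>" "z b + \<epsilon>"] \<epsilon> by auto
    then show "\<exists>r. r \<in> \<rat> \<and> \<bar>r - z b\<bar> < \<epsilon>" by (intro exI[of _ r]) auto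
  qed
  from choice[OF this] obtain y where y: "\<And>b. y b \<in> \<rat>" "\<And>b. \<bar>y b - z b\<bar> < \<epsilon>"
    by auto
  have pos1: "0 < (\<Sum>b\<in>B. y b * \<Phi> H b)" if H: "H \<in> density_matrices A" for H
  proof -
    have bound: "\<bar>\<Phi> H b\<bar> \<le> (\<Sum>i\<in>A. \<Sum>j\<in>A. \<bar>q b (i, j)\<bar>)" for b
    proof -
      have "\<bar>q b (i, j) * H (i, j)\<bar> \<le> \<bar>q b (i, j)\<bar>" for i j
        using density_matrices_abs_le_1[OF A H, of "(i, j)"] by (simp add: abs_mult mult_left_le)
      then show ?thesis unfolding \<Phi>_def
        by (intro order_trans[OF sum_abs] sum_mono) auto
    qed
    have "\<bar>\<Sum>b\<in>B. (y b - z b) * \<Phi> H b\<bar> \<le> (\<Sum>b\<in>B. \<bar>y b - z b\<bar> * \<bar>\<Phi> H b\<bar>)"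
      using sum_abs[of "\<lambda>b. (y b - z b) * \<Phi> H b" B] by (simp add: abs_mult)
    also have "\<dots> \<le> (\<Sum>b\<in>B. \<epsilon> * (\<Sum>i\<in>A. \<Sum>j\<in>A. \<bar>q b (i, j)\<bar>))"
      using y(2) bound \<epsilon> by (intro sum_mono mult_mono) (auto intro: less_imp_le)
    also have "\<dots> = \<epsilon> * M" by (simp add: M_def sum_distrib_left)
    finally have "\<bar>\<Sum>b\<in>B. (y b - z b) * \<Phi> H b\<bar> < c" using \<epsilon> by simp
    then show ?thesis using c_le[OF H] by (simp add: left_diff_distrib sum_subtractf)
  qed
  show ?thesis
  proof (intro exI[of _ y] conjI allI impI)
    show "y b \<in> \<rat>" for b by (rule y(1))
    fix x :: "'a \<Rightarrow> real" assume x: "\<exists>i\<in>A. x i \<noteq> 0"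
    define s where "s = (\<Sum>i\<in>A. (x i)\<^sup>2)"
    have s: "s > 0" unfolding s_def using x A by (meson sum_pos2 zero_le_power2 zero_less_power2)
    define x' where "x' = (\<lambda>i. x i / sqrt s)"
    have "(\<Sum>i\<in>A. (x' i)\<^sup>2) = 1"
      using s by (simp add: x'_def power_divide flip: sum_divide_distrib) (simp add: s_def)
    then have "0 < (\<Sum>b\<in>B. y b * \<Phi> (R x') b)"
      unfolding R_def by (intro pos1 rank_one_density_matrix)
    moreover have "quad_form A (q b) x' = quad_form A (q b) x / s" for b
      using s by (simp add: quad_form_def x'_def sum_divide_distrib)
    ultimately have "0 < (\<Sum>b\<in>B. y b * quad_form A (q b) x) / s"
      by (simp add: \<Phi>R sum_divide_distrib)
    then show "0 < (\<Sum>b\<in>B. y b * quad_form A (q b) x)"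
      using s by (simp add: zero_less_divide_iff)
  qed
qed

section \<open>Supports and sums of squares of polynomials\<close>


lemma finite_Terms_le: "finite (Terms_le t :: 'n::finite monom set)"
proof (rule card_ge_0_finite)
  show "0 < card (Terms_le t :: 'n monom set)"
    by (simp add: card_Terms_le zero_less_binomial)
qed

lemma mdeg_add: "mdeg (\<alpha> + \<beta>) = mdeg \<alpha> + mdeg \<beta>"
  by (simp add: mdeg_def lookup_add sum.distrib)

lemma keys_subset_Terms_le_tdeg: "Poly_Mapping.keys f \<subseteq> Terms_le (tdeg f)"
  by (auto simp: Terms_le_def tdeg_def)

lemma keys_mult_subset_Terms_le:
  assumes "Poly_Mapping.keys p \<subseteq> Terms_le s" "Poly_Mapping.keys q \<subseteq> Terms_le t"
  shows "Poly_Mapping.keys (p * q) \<subseteq> Terms_le (s + t)"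
proof
  fix \<gamma> assume "\<gamma> \<in> Poly_Mapping.keys (p * q)"
  then obtain \<alpha> \<beta> where "\<gamma> = \<alpha> + \<beta>" "\<alpha> \<in> Poly_Mapping.keys p" "\<beta> \<in> Poly_Mapping.keys q"
    using keys_mult[of p q] by blast
  then show "\<gamma> \<in> Terms_le (s + t)"
    using assms by (auto simp: Terms_le_def mdeg_add intro!: add_mono)
qed

lemma keys_mult_square_subset_Terms_le:
  assumes "Poly_Mapping.keys v \<subseteq> Terms_le e" "tdeg f + 2 * e \<le> 2 * d"
  shows "Poly_Mapping.keys (f * v\<^sup>2) \<subseteq> Terms_le (2 * d)"
proof -
  have "Poly_Mapping.keys (f * (v * v)) \<subseteq> Terms_le (tdeg f + (e + e))"
    by (intro keys_mult_subset_Terms_le assms(1) keys_subset_Terms_le_tdeg)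
  then show ?thesis
    using assms(2) by (auto simp: Terms_le_def power2_eq_square)
qed

lemma keys_sum_list_subset:
  assumes "\<And>p. p \<in> set ps \<Longrightarrow> Poly_Mapping.keys p \<subseteq> S"
  shows "Poly_Mapping.keys (sum_list ps) \<subseteq> S"
  using assms
proof (induction ps)
  case (Cons p ps)
  then show ?case using keys_add[of p "sum_list ps"] by auto
qed simp

text \<open>
  Polynomials with support in \<open>S\<close> are parametrised by coefficient vectors, so that the
  coefficients of \<open>f * v\<^sup>2\<close> become quadratic forms in the vector of \<open>v\<close>.
\<close>

definition poly_of :: "'n monom set \<Rightarrow> ('n monom \<Rightarrow> real) \<Rightarrow> 'n rpoly" where
  "poly_of S c = (\<Sum>\<alpha>\<in>S. Poly_Mapping.single \<alpha> (c \<alpha>))"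

lemma lookup_poly_of:
  assumes "finite S"
  shows "Poly_Mapping.lookup (poly_of S c) \<alpha> = (if \<alpha> \<in> S then c \<alpha> else 0)"
  using assms by (simp add: poly_of_def lookup_sum lookup_single when_def)

lemma keys_poly_of: "finite S \<Longrightarrow> Poly_Mapping.keys (poly_of S c) \<subseteq> S"
  by (auto simp: in_keys_iff lookup_poly_of split: if_splits)

lemma poly_of_lookup:
  assumes "finite S" "Poly_Mapping.keys p \<subseteq> S"
  shows "poly_of S (Poly_Mapping.lookup p) = p"
  using assms by (intro poly_mapping_eqI) (auto simp: lookup_poly_of in_keys_iff)

lemma lookup_const_mult:
  "Poly_Mapping.lookup (Poly_Mapping.single 0 c * p) \<alpha> = c * Poly_Mapping.lookup p \<alpha>"
  for p :: "'n rpoly"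
  by (simp add: lookup_mult lookup_single when_mult)

lemma lookup_mult_poly_of_square:
  fixes f :: "'n rpoly"
  shows "Poly_Mapping.lookup (f * (poly_of S c)\<^sup>2) \<gamma> =
    (\<Sum>\<alpha>\<in>S. \<Sum>\<beta>\<in>S. Poly_Mapping.lookup (f * Poly_Mapping.single (\<alpha> + \<beta>) 1) \<gamma> * (c \<alpha> * c \<beta>))"
proof -
  have "f * (poly_of S c)\<^sup>2 =
      (\<Sum>\<alpha>\<in>S. \<Sum>\<beta>\<in>S. f * (Poly_Mapping.single \<alpha> (c \<alpha>) * Poly_Mapping.single \<beta> (c \<beta>)))"
    unfolding poly_of_def power2_eq_square sum_product by (simp only: sum_distrib_left)
  also have "\<dots> = (\<Sum>\<alpha>\<in>S. \<Sum>\<beta>\<in>S.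
      Poly_Mapping.single 0 (c \<alpha> * c \<beta>) * (f * Poly_Mapping.single (\<alpha> + \<beta>) 1))"
  proof (intro sum.cong refl)
    fix \<alpha> \<beta>
    have "Poly_Mapping.single \<alpha> (c \<alpha>) * Poly_Mapping.single \<beta> (c \<beta>) =
        Poly_Mapping.single 0 (c \<alpha> * c \<beta>) * Poly_Mapping.single (\<alpha> + \<beta>) 1"
      by (simp add: mult_single)
    then show "f * (Poly_Mapping.single \<alpha> (c \<alpha>) * Poly_Mapping.single \<beta> (c \<beta>)) =
        Poly_Mapping.single 0 (c \<alpha> * c \<beta>) * (f * Poly_Mapping.single (\<alpha> + \<beta>) 1)"
      by (simp only: mult.left_commute)
  qed
  finally show ?thesis
    by (simp add: lookup_sum lookup_const_mult) (simp only: mult.commute[of "c _ * c _"])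
qed

lemma lookup_sum_list:
  fixes ps :: "'n rpoly list"
  shows "Poly_Mapping.lookup (sum_list ps) \<gamma> = (\<Sum>p\<leftarrow>ps. Poly_Mapping.lookup p \<gamma>)"
  by (induction ps) (simp_all add: lookup_add)

text \<open>
  Leading terms of real squares cannot cancel. Order the terms first by degree and then by the
  linear order of exponent vectors; both are compatible with addition. For the largest term
  \<open>\<alpha>\<close> occurring in any of the polynomials, \<open>2\<alpha>\<close> is a sum of two occurring exponents only as
  \<open>\<alpha> + \<alpha>\<close>, so its coefficient is the sum of the squares of the coefficients of \<open>\<alpha>\<close>.
\<close>

lemma sum_squares_leading_term:
  fixes us :: "'n::{finite,linorder} rpoly list"
  assumes "\<exists>u\<in>set us. u \<noteq> 0"
  shows "\<exists>\<alpha>. (\<forall>u\<in>set us. \<forall>\<beta>\<in>Poly_Mapping.keys u. mdeg \<beta> \<le> mdeg \<alpha>) \<and>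
    \<alpha> + \<alpha> \<in> Poly_Mapping.keys (\<Sum>u\<leftarrow>us. u\<^sup>2)"
proof -
  define K where "K = (\<Union>u\<in>set us. Poly_Mapping.keys u)"
  have finK: "finite K" by (simp add: K_def)
  have "K \<noteq> {}" using assms by (auto simp: K_def)
  define m where "m = Max (mdeg ` K)"
  define \<alpha> where "\<alpha> = Max {\<beta>\<in>K. mdeg \<beta> = m}"
  have m_max: "mdeg \<beta> \<le> m" if "\<beta> \<in> K" for \<beta>
    using finK that by (simp add: m_def)
  have "m \<in> mdeg ` K" unfolding m_def using finK \<open>K \<noteq> {}\<close> by (intro Max_in) auto
  then have "\<alpha> \<in> {\<beta>\<in>K. mdeg \<beta> = m}"
    unfolding \<alpha>_def using finK by (intro Max_in) auto
  then have \<alpha>: "\<alpha> \<in> K" "mdeg \<alpha> = m" by auto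
  have \<alpha>_max: "\<beta> \<le> \<alpha>" if "\<beta> \<in> K" "mdeg \<beta> = m" for \<beta>
    using finK that by (simp add: \<alpha>_def)
  \<comment> \<open>Equal total degree forces both degrees to be maximal; then monotonicity of addition applies.\<close>
  have unique: "\<beta> = \<alpha> \<and> \<gamma> = \<alpha>" if "\<beta> \<in> K" "\<gamma> \<in> K" "\<beta> + \<gamma> = \<alpha> + \<alpha>" for \<beta> \<gamma>
  proof -
    have "mdeg \<beta> + mdeg \<gamma> = m + m" using that(3) \<alpha>(2) by (metis mdeg_add)
    then have "mdeg \<beta> = m" "mdeg \<gamma> = m" using m_max[OF that(1)] m_max[OF that(2)] by auto
    then have le: "\<beta> \<le> \<alpha>" "\<gamma> \<le> \<alpha>" using \<alpha>_max that by auto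
    have "\<not> \<beta> < \<alpha>" using add_less_le_mono[of \<beta> \<alpha> \<gamma> \<alpha>] le(2) that(3) by auto
    moreover have "\<not> \<gamma> < \<alpha>" using add_le_less_mono[of \<beta> \<alpha> \<gamma> \<alpha>] le(1) that(3) by auto
    ultimately show ?thesis using le by auto
  qed
  have coeff: "Poly_Mapping.lookup (u\<^sup>2) (\<alpha> + \<alpha>) = (Poly_Mapping.lookup u \<alpha>)\<^sup>2" if "u \<in> set us" for u
  proof -
    let ?c = "Poly_Mapping.lookup u"
    have "Poly_Mapping.keys u \<subseteq> K" using that by (auto simp: K_def)
    then have "Poly_Mapping.lookup (u\<^sup>2) (\<alpha> + \<alpha>) =
        (\<Sum>\<beta>\<in>K. \<Sum>\<gamma>\<in>K. Poly_Mapping.lookup (Poly_Mapping.single (\<beta> + \<gamma>) 1) (\<alpha> + \<alpha>) * (?c \<beta> * ?c \<gamma>))"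
      using lookup_mult_poly_of_square[of 1 K ?c "\<alpha> + \<alpha>"] poly_of_lookup[OF finK] by simp
    also have "\<dots> = (\<Sum>\<beta>\<in>K. \<Sum>\<gamma>\<in>K. if \<gamma> = \<alpha> then if \<beta> = \<alpha> then (?c \<alpha>)\<^sup>2 else 0 else 0)"
    proof (intro sum.cong refl)
      fix \<beta> \<gamma> assume "\<beta> \<in> K" "\<gamma> \<in> K"
      then show "Poly_Mapping.lookup (Poly_Mapping.single (\<beta> + \<gamma>) 1) (\<alpha> + \<alpha>) * (?c \<beta> * ?c \<gamma>) =
          (if \<gamma> = \<alpha> then if \<beta> = \<alpha> then (?c \<alpha>)\<^sup>2 else 0 else 0)"
        using unique[of \<beta> \<gamma>] by (auto simp: lookup_single when_def power2_eq_square)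
    qed
    also have "\<dots> = (?c \<alpha>)\<^sup>2" using finK \<alpha>(1) by simp
    finally show ?thesis .
  qed
  obtain u where u: "u \<in> set us" "\<alpha> \<in> Poly_Mapping.keys u" using \<alpha>(1) by (auto simp: K_def)
  have "0 < (Poly_Mapping.lookup u \<alpha>)\<^sup>2" using u by (simp add: in_keys_iff)
  also have "\<dots> \<le> (\<Sum>u\<leftarrow>us. (Poly_Mapping.lookup u \<alpha>)\<^sup>2)"
    using u(1) by (intro member_le_sum_list) auto
  also have "\<dots> = (\<Sum>u\<leftarrow>us. Poly_Mapping.lookup (u\<^sup>2) (\<alpha> + \<alpha>))"
    by (intro arg_cong[of _ _ sum_list] map_cong) (simp_all add: coeff)
  also have "\<dots> = Poly_Mapping.lookup (\<Sum>u\<leftarrow>us. u\<^sup>2) (\<alpha> + \<alpha>)"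
    by (simp add: lookup_sum_list o_def)
  finally have "\<alpha> + \<alpha> \<in> Poly_Mapping.keys (\<Sum>u\<leftarrow>us. u\<^sup>2)" by (simp add: in_keys_iff)
  moreover have "mdeg \<beta> \<le> mdeg \<alpha>" if "u \<in> set us" "\<beta> \<in> Poly_Mapping.keys u" for u \<beta>
    using that m_max \<alpha>(2) by (auto simp: K_def)
  ultimately show ?thesis by blast
qed

lemma sum_squares_eq_0_imp:
  fixes us :: "'n::{finite,linorder} rpoly list"
  assumes "(\<Sum>u\<leftarrow>us. u\<^sup>2) = 0" "u \<in> set us"
  shows "u = 0"
proof (rule ccontr)
  assume "u \<noteq> 0"
  then have "\<exists>u\<in>set us. u \<noteq> 0" using assms(2) by blast
  from sum_squares_leading_term[OF this] show False using assms(1) by auto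
qed

lemma sum_squares_keys_subset_imp:
  fixes us :: "'n::{finite,linorder} rpoly list"
  assumes "Poly_Mapping.keys (\<Sum>u\<leftarrow>us. u\<^sup>2) \<subseteq> Terms_le (2 * d)" "u \<in> set us"
  shows "Poly_Mapping.keys u \<subseteq> Terms_le d"
proof (cases "u = 0")
  case False
  then have "\<exists>u\<in>set us. u \<noteq> 0" using assms(2) by blast
  from sum_squares_leading_term[OF this] obtain \<alpha>
    where \<alpha>: "\<And>\<beta>. \<beta> \<in> Poly_Mapping.keys u \<Longrightarrow> mdeg \<beta> \<le> mdeg \<alpha>"
      "\<alpha> + \<alpha> \<in> Poly_Mapping.keys (\<Sum>u\<leftarrow>us. u\<^sup>2)"
    using assms(2) by blast
  have "mdeg \<alpha> + mdeg \<alpha> \<le> 2 * d" using \<alpha>(2) assms(1) by (auto simp: Terms_le_def mdeg_add)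
  then show ?thesis using \<alpha>(1) by (fastforce simp: Terms_le_def)
qed simp

section \<open>Certificates\<close>

lemma lin_form_add: "lin_form t y (p + q) = lin_form t y p + lin_form t y q"
  by (simp add: lin_form_def lookup_add distrib_left sum.distrib)

lemma lin_form_sum_list: "lin_form t y (\<Sum>u\<leftarrow>us. h u) = (\<Sum>u\<leftarrow>us. lin_form t y (h u))"
  by (induction us) (simp_all add: lin_form_add, simp add: lin_form_def)

lemma lin_form_uminus: "lin_form t y (- p) = - lin_form t y p"
  by (simp add: lin_form_def sum_negf)

text \<open>Clearing denominators moves the question from the fraction field to polynomials.\<close>

lemma Fract_in_SOS_frac_iff:
  fixes f :: "'n::{finite,linorder} rpoly"
  shows "Fract f 1 \<in> SOS_frac T \<longleftrightarrow> (\<exists>us vs. (\<forall>v\<in>set vs. Poly_Mapping.keys v \<subseteq> T) \<and>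
    (\<Sum>v\<leftarrow>vs. v\<^sup>2) \<noteq> 0 \<and> f * (\<Sum>v\<leftarrow>vs. v\<^sup>2) = (\<Sum>u\<leftarrow>us. u\<^sup>2))"
proof -
  have "Fract f 1 = Fract a b \<longleftrightarrow> f * b = a" if "b \<noteq> 0" for a b :: "'n rpoly"
    using that by (simp add: eq_fract)
  then show ?thesis
    unfolding SOS_frac_def by blast
qed

text \<open>
  Applying the functional to \<open>f * (\<Sum>v\<^sup>2) = (\<Sum>u\<^sup>2)\<close> gives a negative number on the left and a
  nonnegative one on the right. The functional only controls squares of polynomials of degree
  at most \<open>d\<close>; the \<open>u\<close> satisfy this because the left side has degree at most \<open>2d\<close> and
  leading terms do not cancel.
\<close>

lemma certificate_imp_not_SOS_frac:
  fixes f :: "'n::{finite,linorder} rpoly"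
  assumes deg: "tdeg f + 2 * e \<le> 2 * d" and T: "T \<subseteq> Terms_le e"
    and neg: "\<And>v. v \<noteq> 0 \<Longrightarrow> Poly_Mapping.keys v \<subseteq> T \<Longrightarrow> lin_form (2 * d) y (f * v\<^sup>2) < 0"
    and nonneg: "\<And>u. Poly_Mapping.keys u \<subseteq> Terms_le d \<Longrightarrow> 0 \<le> lin_form (2 * d) y (u\<^sup>2)"
  shows "Fract f 1 \<notin> SOS_frac T"
proof
  assume "Fract f 1 \<in> SOS_frac T"
  then obtain us vs where vs: "\<And>v. v \<in> set vs \<Longrightarrow> Poly_Mapping.keys v \<subseteq> T"
    and nz: "(\<Sum>v\<leftarrow>vs. v\<^sup>2) \<noteq> 0" and eq: "(\<Sum>v\<leftarrow>vs. f * v\<^sup>2) = (\<Sum>u\<leftarrow>us. u\<^sup>2)"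
    by (auto simp: Fract_in_SOS_frac_iff sum_list_const_mult)
  have "Poly_Mapping.keys (\<Sum>v\<leftarrow>vs. f * v\<^sup>2) \<subseteq> Terms_le (2 * d)"
    using vs T deg by (intro keys_sum_list_subset) (auto dest!: keys_mult_square_subset_Terms_le[rotated])
  then have "0 \<le> (\<Sum>u\<leftarrow>us. lin_form (2 * d) y (u\<^sup>2))"
    unfolding eq by (intro sum_list_nonneg) (auto intro!: nonneg dest: sum_squares_keys_subset_imp)
  also have "\<dots> = (\<Sum>v\<leftarrow>vs. lin_form (2 * d) y (f * v\<^sup>2))"
    using arg_cong[OF eq, of "lin_form (2 * d) y"] by (simp add: lin_form_sum_list)
  also have "\<dots> < 0"
  proof -
    have "\<exists>v\<in>set vs. v \<noteq> 0"
    proof (rule ccontr)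
      assume "\<not> (\<exists>v\<in>set vs. v \<noteq> 0)"
      then have "(\<Sum>v\<leftarrow>vs. v\<^sup>2) = (\<Sum>v\<leftarrow>vs. 0)"
        by (intro arg_cong[of _ _ sum_list] map_cong) auto
      then show False using nz by (simp only: sum_list_0)
    qed
    then obtain v where v: "v \<in> set vs" "v \<noteq> 0" by blast
    then obtain xs ys where split: "vs = xs @ v # ys" by (meson split_list)
    have nonpos: "lin_form (2 * d) y (f * w\<^sup>2) \<le> 0" if "w \<in> set vs" for w
      using neg[of w] vs[OF that] by (cases "w = 0") (auto simp: lin_form_def)
    have "(\<Sum>w\<leftarrow>ws. lin_form (2 * d) y (f * w\<^sup>2)) \<le> 0" if "set ws \<subseteq> set vs" for ws
      using nonpos that by (intro sum_list_nonpos) auto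
    from this[of xs] this[of ys] have "(\<Sum>w\<leftarrow>xs. lin_form (2 * d) y (f * w\<^sup>2)) \<le> 0"
      "(\<Sum>w\<leftarrow>ys. lin_form (2 * d) y (f * w\<^sup>2)) \<le> 0"
      unfolding split by auto
    then show ?thesis
      using neg[OF v(2) vs[OF v(1)]] by (simp add: split)
  qed
  finally show False by simp
qed


text \<open>
  The alternative is applied to the quadratic map \<open>(u, v) \<mapsto> u\<^sup>2 - f * v\<^sup>2\<close>: a nontrivial relation
  \<open>\<Sum>u\<^sup>2 = f * (\<Sum>v\<^sup>2)\<close> either exhibits \<open>f\<close> as a fraction of the excluded kind or has
  \<open>\<Sum>v\<^sup>2 = 0\<close>, whence \<open>\<Sum>u\<^sup>2 = 0\<close> and every \<open>u\<close> and \<open>v\<close> is zero. Treating \<open>u\<close> and \<open>v\<close> together yields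
  strict positivity on squares as well, which leaves room for the rational perturbation.
\<close>

lemma not_SOS_frac_imp_certificate:
  fixes f :: "'n::{finite,linorder} rpoly"
  assumes deg: "tdeg f + 2 * e \<le> 2 * d" and T: "T \<subseteq> Terms_le e"
    and not_SOS: "Fract f 1 \<notin> SOS_frac T"
  shows "\<exists>y. (\<forall>\<alpha>. y \<alpha> \<in> \<rat>) \<and>
    (\<forall>v. v \<noteq> 0 \<longrightarrow> Poly_Mapping.keys v \<subseteq> T \<longrightarrow> lin_form (2 * d) y (f * v\<^sup>2) < 0) \<and>
    (\<forall>u. u \<noteq> 0 \<longrightarrow> Poly_Mapping.keys u \<subseteq> Terms_le d \<longrightarrow> 0 < lin_form (2 * d) y (u\<^sup>2))"
proof -
  define D where "D = (Terms_le d :: 'n monom set)"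
  define A where "A = D <+> T"
  have fin: "finite D" "finite T"
    using finite_Terms_le T by (auto simp: D_def intro: finite_subset)
  define U where "U x = poly_of D (x \<circ> Inl)" for x :: "'n monom + 'n monom \<Rightarrow> real"
  define V where "V x = poly_of T (x \<circ> Inr)" for x :: "'n monom + 'n monom \<Rightarrow> real"
  \<comment> \<open>The matrix of the coefficient of \<open>\<gamma>\<close> in \<open>u\<^sup>2 - f * v\<^sup>2\<close>; the blocks mixing \<open>u\<close> and \<open>v\<close> vanish.\<close>
  define q where "q \<gamma> = (\<lambda>p. case p of
      (Inl \<alpha>, Inl \<beta>) \<Rightarrow> Poly_Mapping.lookup (1 * Poly_Mapping.single (\<alpha> + \<beta>) 1) \<gamma>
    | (Inr \<alpha>, Inr \<beta>) \<Rightarrow> - Poly_Mapping.lookup (f * Poly_Mapping.single (\<alpha> + \<beta>) 1) \<gamma>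
    | _ \<Rightarrow> 0)" for \<gamma>
  have quad: "quad_form A (q \<gamma>) x = Poly_Mapping.lookup ((U x)\<^sup>2 - f * (V x)\<^sup>2) \<gamma>" for \<gamma> x
  proof -
    have "quad_form A (q \<gamma>) x = Poly_Mapping.lookup (1 * (U x)\<^sup>2) \<gamma> - Poly_Mapping.lookup (f * (V x)\<^sup>2) \<gamma>"
      unfolding U_def V_def lookup_mult_poly_of_square
      using fin by (simp add: quad_form_def A_def q_def sum.Plus sum_negf)
    then show ?thesis by (simp add: lookup_minus)
  qed
  have keys_UV: "Poly_Mapping.keys (U x) \<subseteq> Terms_le d" "Poly_Mapping.keys (V x) \<subseteq> T" for x
    using keys_poly_of[OF fin(1)] keys_poly_of[OF fin(2)] by (auto simp: U_def V_def D_def)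
  have keys_sq: "Poly_Mapping.keys (u\<^sup>2) \<subseteq> Terms_le (2 * d)" if "Poly_Mapping.keys u \<subseteq> Terms_le d" for u :: "'n rpoly"
    using keys_mult_subset_Terms_le[OF that that] by (simp add: power2_eq_square mult_2)
  have keys_fsq: "Poly_Mapping.keys (f * v\<^sup>2) \<subseteq> Terms_le (2 * d)" if "Poly_Mapping.keys v \<subseteq> T" for v
    using keys_mult_square_subset_Terms_le[OF _ deg] that T by blast
  have "\<exists>y. (\<forall>\<gamma>. y \<gamma> \<in> \<rat>) \<and>
      (\<forall>x. (\<exists>i\<in>A. x i \<noteq> 0) \<longrightarrow> 0 < (\<Sum>\<gamma>\<in>Terms_le (2 * d). y \<gamma> * quad_form A (q \<gamma>) x))"
  proof (rule quadratic_map_alternative)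
    show "finite A" using fin by (simp add: A_def)
    show "finite (Terms_le (2 * d) :: 'n monom set)" by (rule finite_Terms_le)
    fix xs assume zero: "\<forall>\<gamma>\<in>Terms_le (2 * d). (\<Sum>x\<leftarrow>xs. quad_form A (q \<gamma>) x) = 0"
    let ?us = "map U xs" and ?vs = "map V xs"
    let ?r = "\<Sum>x\<leftarrow>xs. (U x)\<^sup>2 - f * (V x)\<^sup>2"
    have "?r = 0"
    proof (rule poly_mapping_eqI)
      fix \<gamma>
      have "Poly_Mapping.keys ?r \<subseteq> Terms_le (2 * d)"
      proof (rule keys_sum_list_subset)
        fix p assume "p \<in> set (map (\<lambda>x. (U x)\<^sup>2 - f * (V x)\<^sup>2) xs)"
        then obtain x where "p = (U x)\<^sup>2 - f * (V x)\<^sup>2" by auto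
        then show "Poly_Mapping.keys p \<subseteq> Terms_le (2 * d)"
          using keys_diff[of "(U x)\<^sup>2" "f * (V x)\<^sup>2"] keys_sq[OF keys_UV(1)[of x]] keys_fsq[OF keys_UV(2)[of x]]
          by blast
      qed
      moreover have "Poly_Mapping.lookup ?r \<gamma> = 0" if "\<gamma> \<in> Terms_le (2 * d)"
        using zero that by (simp add: lookup_sum_list o_def quad)
      ultimately show "Poly_Mapping.lookup ?r \<gamma> = Poly_Mapping.lookup 0 \<gamma>"
        by (auto simp: in_keys_iff)
    qed
    then have eq: "f * (\<Sum>v\<leftarrow>?vs. v\<^sup>2) = (\<Sum>u\<leftarrow>?us. u\<^sup>2)"
      by (simp add: sum_list_subtractf o_def sum_list_const_mult)
    have "(\<Sum>v\<leftarrow>?vs. v\<^sup>2) = 0"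
    proof (rule ccontr)
      assume "(\<Sum>v\<leftarrow>?vs. v\<^sup>2) \<noteq> 0"
      then have "\<exists>us vs. (\<forall>v\<in>set vs. Poly_Mapping.keys v \<subseteq> T) \<and>
          (\<Sum>v\<leftarrow>vs. v\<^sup>2) \<noteq> 0 \<and> f * (\<Sum>v\<leftarrow>vs. v\<^sup>2) = (\<Sum>u\<leftarrow>us. u\<^sup>2)"
        using eq keys_UV(2) by (intro exI[of _ ?us] exI[of _ ?vs]) auto
      then show False using not_SOS by (simp add: Fract_in_SOS_frac_iff)
    qed
    moreover from this have "(\<Sum>u\<leftarrow>?us. u\<^sup>2) = 0" using eq by simp
    ultimately have UV0: "U x = 0" "V x = 0" if "x \<in> set xs" for x
      using that sum_squares_eq_0_imp[of ?us "U x"] sum_squares_eq_0_imp[of ?vs "V x"] by auto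
    show "\<forall>x\<in>set xs. \<forall>i\<in>A. x i = 0"
    proof (intro ballI)
      fix x i assume x: "x \<in> set xs" and "i \<in> A"
      then consider \<alpha> where "i = Inl \<alpha>" "\<alpha> \<in> D" | \<alpha> where "i = Inr \<alpha>" "\<alpha> \<in> T"
        by (auto simp: A_def)
      then show "x i = 0"
      proof cases
        case 1
        then show ?thesis
          using lookup_poly_of[OF fin(1), of "x \<circ> Inl" \<alpha>] UV0(1)[OF x] by (simp add: U_def)
      next
        case 2
        then show ?thesis
          using lookup_poly_of[OF fin(2), of "x \<circ> Inr" \<alpha>] UV0(2)[OF x] by (simp add: V_def)
      qed
    qed
  qed
  then obtain y where y: "\<And>\<gamma>. y \<gamma> \<in> \<rat>"
    and pos: "\<And>x. \<exists>i\<in>A. x i \<noteq> 0 \<Longrightarrow> 0 < (\<Sum>\<gamma>\<in>Terms_le (2 * d). y \<gamma> * quad_form A (q \<gamma>) x)"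
    by blast
  have pos': "0 < lin_form (2 * d) y (u\<^sup>2 - f * v\<^sup>2)"
    if u: "Poly_Mapping.keys u \<subseteq> Terms_le d" and v: "Poly_Mapping.keys v \<subseteq> T" and nz: "u \<noteq> 0 \<or> v \<noteq> 0" for u v
  proof -
    define x where "x = case_sum (Poly_Mapping.lookup u) (Poly_Mapping.lookup v)"
    have x: "x \<circ> Inl = Poly_Mapping.lookup u" "x \<circ> Inr = Poly_Mapping.lookup v"
      by (auto simp: x_def)
    have UV: "U x = u" "V x = v"
      using poly_of_lookup fin u v by (simp_all add: U_def V_def x D_def)
    have "\<exists>i\<in>A. x i \<noteq> 0"
    proof (rule ccontr)
      assume zero: "\<not> (\<exists>i\<in>A. x i \<noteq> 0)"
      have "x (Inl \<alpha>) = 0" if "\<alpha> \<in> D" for \<alpha>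
        using zero that by (auto simp: A_def)
      moreover have "x (Inr \<alpha>) = 0" if "\<alpha> \<in> T" for \<alpha>
        using zero that by (auto simp: A_def)
      ultimately have "U x = 0" "V x = 0"
        by (simp_all add: U_def V_def poly_of_def)
      then show False using UV nz by auto
    qed
    from pos[OF this] show ?thesis by (simp add: quad UV lin_form_def)
  qed
  show ?thesis
  proof (intro exI[of _ y] conjI allI impI)
    show "y \<alpha> \<in> \<rat>" for \<alpha> by (rule y)
    show "lin_form (2 * d) y (f * v\<^sup>2) < 0" if "v \<noteq> 0" "Poly_Mapping.keys v \<subseteq> T" for v
      using pos'[of 0 v] that by (simp add: lin_form_uminus)
    show "0 < lin_form (2 * d) y (u\<^sup>2)" if "u \<noteq> 0" "Poly_Mapping.keys u \<subseteq> Terms_le d" for u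
      using pos'[of u 0] that by simp
  qed
qed

lemma lin_form_restrict: "lin_form t (restrict y (Terms_le t)) = lin_form t y"
  by (simp add: lin_form_def fun_eq_iff)

theorem theorem2p7:
  fixes f :: "'n::{finite,linorder} rpoly" and e d :: nat and T :: "'n monom set"
  assumes "\<And>\<alpha>. Poly_Mapping.lookup f \<alpha> \<in> \<rat>"
    and "d = nat \<lceil>real e + real (tdeg f) / 2\<rceil>"
    and "T \<subseteq> Terms_le e"
  shows "Fract f 1 \<notin> SOS_frac T \<longleftrightarrow>
    (\<exists>y \<in> Terms_le (2 * d) \<rightarrow>\<^sub>E \<rat>.
       (\<forall>v :: 'n rpoly. v \<noteq> 0 \<and> Poly_Mapping.keys v \<subseteq> T \<longrightarrow> lin_form (2 * d) y (f * v\<^sup>2) < 0) \<and>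
       (\<forall>u :: 'n rpoly. Poly_Mapping.keys u \<subseteq> Terms_le d \<longrightarrow> lin_form (2 * d) y (u\<^sup>2) \<ge> 0))"
proof -
  have "real e + real (tdeg f) / 2 \<le> real d"
    unfolding assms(2) by (rule real_nat_ceiling_ge)
  then have deg: "tdeg f + 2 * e \<le> 2 * d" by linarith
  show ?thesis
  proof
    assume "Fract f 1 \<notin> SOS_frac T"
    then obtain y where y: "\<And>\<alpha>. y \<alpha> \<in> \<rat>"
      "\<And>v. v \<noteq> 0 \<Longrightarrow> Poly_Mapping.keys v \<subseteq> T \<Longrightarrow> lin_form (2 * d) y (f * v\<^sup>2) < 0"
      "\<And>u. u \<noteq> 0 \<Longrightarrow> Poly_Mapping.keys u \<subseteq> Terms_le d \<Longrightarrow> 0 < lin_form (2 * d) y (u\<^sup>2)"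
      using not_SOS_frac_imp_certificate[OF deg assms(3)] by blast
    have "0 \<le> lin_form (2 * d) y (u\<^sup>2)" if "Poly_Mapping.keys u \<subseteq> Terms_le d" for u
      using y(3)[OF _ that] by (cases "u = 0") (auto simp: lin_form_def intro: less_imp_le)
    then show "\<exists>y \<in> Terms_le (2 * d) \<rightarrow>\<^sub>E \<rat>.
       (\<forall>v :: 'n rpoly. v \<noteq> 0 \<and> Poly_Mapping.keys v \<subseteq> T \<longrightarrow> lin_form (2 * d) y (f * v\<^sup>2) < 0) \<and>
       (\<forall>u :: 'n rpoly. Poly_Mapping.keys u \<subseteq> Terms_le d \<longrightarrow> lin_form (2 * d) y (u\<^sup>2) \<ge> 0)"
      using y(1,2) by (intro bexI[of _ "restrict y (Terms_le (2 * d))"]) (auto simp: lin_form_restrict)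
  next
    assume "\<exists>y \<in> Terms_le (2 * d) \<rightarrow>\<^sub>E \<rat>.
       (\<forall>v :: 'n rpoly. v \<noteq> 0 \<and> Poly_Mapping.keys v \<subseteq> T \<longrightarrow> lin_form (2 * d) y (f * v\<^sup>2) < 0) \<and>
       (\<forall>u :: 'n rpoly. Poly_Mapping.keys u \<subseteq> Terms_le d \<longrightarrow> lin_form (2 * d) y (u\<^sup>2) \<ge> 0)"
    then show "Fract f 1 \<notin> SOS_frac T"
      using certificate_imp_not_SOS_frac[OF deg assms(3)] by blast
  qed
qed

end
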